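(* Let $\mathscr{A}=\{a_1,\ldots,a_n\}\subset\mathbb{Z}$ be a finite set such that $0<a_1<\cdots<a_n$ and $\gcd(a_1,\ldots,a_n)=1$. Let $v(\mathscr{A}):=\min\{a_i\mid \gcd(a_1,\ldots,a_i)=1\}$. Then $v(\mathscr{A}^1)\leq v(\mathscr{A})-2$. Therefore, if $a_1>1$, after at most $\lfloor \frac{v(\mathscr{A})}{2}\rfloor$ iterations of the algorithm, the resulting set contains $1$. In other words, $\eta(\mathscr{A})\leq\lfloor \frac{v(\mathscr{A})}{2}\rfloor$.
   Context: For a finite set $\mathscr{A}=\{a_1,\ldots,a_n\}\subset\mathbb{Z}$ with $0<a_1<\cdots<a_n$ and $\gcd(a_1,\ldots,a_n)=1$, put $\mathscr{A}':=\{a_1\}\cup\{a_2-a_1,\ldots,a_n-a_1\}$. This is again a finite set of positive integers with gcd $1$, and its elements are listed in increasing order (without repetition). The algorithm replaces $\mathscr{A}$ by $\mathscr{A}'$ repeatedly, stopping when the resulting set contains $1$. Put $\mathscr{A}^1:=\mathscr{A}'$ and $\mathscr{A}^k:=(\mathscr{A}^{k-1})'$ for $k\geq 2$. The quantity $v$ is defined for any such set with its elements listed in increasing order, so it applies to $\mathscr{A}^1$ as well. $\eta(\mathscr{A})$ denotes the number of iterations of Nash modification required to resolve the singularities of the toric curve defined by $\mathscr{A}$; in other words, $\eta(\mathscr{A})$ is the minimum $k\in\mathbb{N}$ such that $1\in\mathscr{A}^k$.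
   Formalization: The inequality v(A^1) ≤ v(A) − 2 is stated only for a_1 > 1, since for a_1 = 1 (e.g. A = {1}) v(A) = 1 and it always fails; η(A) is taken as 0 when A already contains 1. *)

theory Defs
  imports Complex_Main
begin

text \<open>
  A set \<open>A = {a\<^sub>1 < \<dots> < a\<^sub>n}\<close> is represented by \<open>A :: int set\<close>, without an explicit enumeration:
  \<open>a\<^sub>1\<close> is \<^term>\<open>Min A\<close>, and \<open>{a\<^sub>1, \<dots>, a\<^sub>i}\<close> is \<open>{b \<in> A. b \<le> a\<^sub>i}\<close>.
\<close>

definition nash_step :: "int set \<Rightarrow> int set" where
  "nash_step A = insert (Min A) ((\<lambda>a. a - Min A) ` (A - {Min A}))"

definition nash_iter :: "nat \<Rightarrow> int set \<Rightarrow> int set" where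
  "nash_iter k A = (nash_step ^^ k) A"

definition v :: "int set \<Rightarrow> int" where
  "v A = Min {a \<in> A. Gcd {b \<in> A. b \<le> a} = 1}"

text \<open>
  The index \<open>k = 0\<close> is admitted, with \<open>nash_iter 0 A = A\<close>: no iteration is needed if \<open>1 \<in> A\<close>.
  The value is meaningful only if some iterate contains \<open>1\<close>.
\<close>

definition eta :: "int set \<Rightarrow> nat" where
  "eta A = (LEAST k. 1 \<in> nash_iter k A)"

end

theory Submission imports Defs begin

text \<open>
  Write \<open>m = Min A\<close> and \<open>w = v A\<close>. Subtracting one member of a set from the others leaves the gcd
  unchanged (\<open>Gcd_nash_step\<close>). Hence the step also turns the initial segment \<open>{b \<in> A. b \<le> w}\<close>,
  whose gcd is \<open>1\<close>, into a subset of \<open>nash_step A\<close> with gcd \<open>1\<close>. The members of that subset are \<open>m\<close>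
  and differences \<open>b - m\<close> with \<open>b \<le> w\<close>, so \<open>v (nash_step A) \<le> max m (w - m)\<close> by \<open>v_le\<close>.
  If \<open>m > 1\<close>, the second entry is at most \<open>w - 2\<close>. Moreover \<open>m < w\<close>, as \<open>m\<close> alone has gcd \<open>m \<noteq> 1\<close>. So
  the first entry is at most \<open>w - 2\<close> as well, unless \<open>w = m + 1\<close>; in that case
  \<open>1 = w - m\<close> is a member of \<open>nash_step A\<close>, so \<open>v (nash_step A) \<le> 1 \<le> w - 2\<close>.

  Each step therefore lowers \<open>v div 2\<close> by at least one for as long as the minimum exceeds \<open>1\<close>, and
  \<open>v \<ge> 3\<close> holds at every such stage, which leaves room for the step that finally produces \<open>1\<close>.
\<close>

lemma finite_nash_step: "finite A \<Longrightarrow> finite (nash_step A)"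
  by (simp add: nash_step_def)

lemma nash_step_pos:
  assumes "finite A" "\<forall>a\<in>A. 0 < a" "A \<noteq> {}" "x \<in> nash_step A"
  shows "0 < x"
proof -
  have "0 < Min A"
    using assms(1-3) by simp
  moreover have "0 < a - Min A" if "a \<in> A - {Min A}" for a
    using that Min_le[OF assms(1), of a] by auto
  ultimately show ?thesis
    using assms(4) unfolding nash_step_def by blast
qed

text \<open>
  An integer divides all of \<open>m\<close> and the differences \<open>b - m\<close> exactly if it divides \<open>m\<close> and all the
  \<open>b\<close>.
\<close>

lemma Gcd_nash_step:
  assumes "finite A" "A \<noteq> {}"
  shows "Gcd (nash_step A) = Gcd A"
proof (rule zdvd_antisym_nonneg)
  have m: "Min A \<in> A"
    using assms by simp
  show "Gcd (nash_step A) dvd Gcd A"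
  proof (rule Gcd_greatest)
    fix b assume "b \<in> A"
    have dm: "Gcd (nash_step A) dvd Min A"
      by (rule Gcd_dvd) (simp add: nash_step_def)
    show "Gcd (nash_step A) dvd b"
    proof (cases "b = Min A")
      case False
      with \<open>b \<in> A\<close> have "Gcd (nash_step A) dvd b - Min A"
        by (intro Gcd_dvd) (simp add: nash_step_def)
      from dvd_add[OF this dm] have "Gcd (nash_step A) dvd (b - Min A) + Min A" .
      then show ?thesis by simp
    qed (use dm in simp)
  qed
  show "Gcd A dvd Gcd (nash_step A)"
    by (rule Gcd_greatest) (use m in \<open>auto simp: nash_step_def\<close>)
qed simp_all

lemma v_attained:
  assumes "finite A" "Gcd A = 1"
  shows "v A \<in> A" "Gcd {b \<in> A. b \<le> v A} = 1"
proof -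
  have "A \<noteq> {}"
    using assms by auto
  \<comment> \<open>The minimum defining \<open>v A\<close> is over a nonempty set: the largest member of \<open>A\<close> qualifies.\<close>
  then have "Max A \<in> {a \<in> A. Gcd {b \<in> A. b \<le> a} = 1}"
    using assms Collect_mem_eq[of A] by (auto cong: conj_cong)
  then have "v A \<in> {a \<in> A. Gcd {b \<in> A. b \<le> a} = 1}"
    unfolding v_def using assms(1) by (intro Min_in) auto
  then show "v A \<in> A" "Gcd {b \<in> A. b \<le> v A} = 1"
    by auto
qed

text \<open>
  The initial segment of \<open>A\<close> ending at \<open>Max S\<close> contains \<open>S\<close>, so its gcd divides that of \<open>S\<close>. Hence
  \<open>v\<close> can be bounded from any subset with gcd \<open>1\<close>, whether or not it is an initial segment.
\<close>

lemma v_le: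
  assumes "finite A" "S \<subseteq> A" "Gcd S = 1" "\<And>s. s \<in> S \<Longrightarrow> s \<le> c"
  shows "v A \<le> c"
proof -
  have S: "finite S" "S \<noteq> {}"
    using assms finite_subset by auto
  have "Gcd {b \<in> A. b \<le> Max S} dvd Gcd S"
    using assms(2) S(1) by (intro Gcd_greatest Gcd_dvd) auto
  then have "Gcd {b \<in> A. b \<le> Max S} = 1"
    using assms(3) by simp
  then have "v A \<le> Max S"
    unfolding v_def using assms(1,2) Max_in[OF S] by (intro Min_le) auto
  also have "Max S \<le> c"
    using assms(4) Max_in[OF S] .
  finally show ?thesis .
qed

lemma Min_less_v:
  assumes "finite A" "Gcd A = 1" "1 < Min A"
  shows "Min A < v A"
proof (rule ccontr)
  assume "\<not> Min A < v A"
  then have "{b \<in> A. b \<le> v A} = {v A}"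
    using v_attained(1)[OF assms(1,2)] Min_le[OF assms(1)] by force
  then have "v A = 1"
    using v_attained(2)[OF assms(1,2)] assms(3) Min_le[OF assms(1) v_attained(1)[OF assms(1,2)]]
    by simp
  then show False
    using assms(3) Min_le[OF assms(1) v_attained(1)[OF assms(1,2)]] by simp
qed

lemma v_nash_step_le:
  assumes "finite A" "Gcd A = 1" "1 < Min A"
  shows "v (nash_step A) \<le> v A - 2"
proof (cases "v A = Min A + 1")
  case True
  have "1 \<in> nash_step A"
    using True v_attained(1)[OF assms(1,2)] by (force simp: nash_step_def)
  then have "v (nash_step A) \<le> 1"
    using assms(1) by (intro v_le[where S = "{1}"]) (auto simp: finite_nash_step)
  then show ?thesis
    using True assms(3) by simp
next
  case False
  define B where "B = {b \<in> A. b \<le> v A}"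
  have lt: "Min A < v A"
    using Min_less_v assms by blast
  have "A \<noteq> {}"
    using assms(2) by auto
  have B: "finite B" "B \<noteq> {}" "Gcd B = 1"
    using assms v_attained[OF assms(1,2)] by (auto simp: B_def)
  have MinB: "Min B = Min A"
    using assms(1) \<open>A \<noteq> {}\<close> lt by (intro Min_eqI) (auto simp: B_def)
  show ?thesis
  proof (rule v_le[where S = "nash_step B"])
    show "nash_step B \<subseteq> nash_step A"
      unfolding nash_step_def MinB by (auto simp: B_def)
    show "Gcd (nash_step B) = 1"
      using B Gcd_nash_step by simp
    show "s \<le> v A - 2" if "s \<in> nash_step B" for s
      using that lt False assms(3) unfolding nash_step_def MinB by (auto simp: B_def)
  qed (use assms(1) finite_nash_step in blast)
qed

lemma nash_iter_Suc: "nash_iter (Suc k) A = nash_iter k (nash_step A)"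
  by (simp add: nash_iter_def funpow_swap1)

lemma one_in_nash_iter:
  assumes "finite A" "\<forall>a\<in>A. 0 < a" "Gcd A = 1" "1 < Min A"
  shows "\<exists>k\<ge>1. int k \<le> v A div 2 \<and> 1 \<in> nash_iter k A"
  using assms
proof (induction "nat (v A)" arbitrary: A rule: less_induct)
  case less
  let ?A' = "nash_step A"
  have "A \<noteq> {}"
    using less.prems by auto
  have A': "finite ?A'" "\<forall>a\<in>?A'. 0 < a" "Gcd ?A' = 1" "?A' \<noteq> {}"
    using less.prems \<open>A \<noteq> {}\<close> finite_nash_step nash_step_pos Gcd_nash_step
    by (auto simp: nash_step_def)
  have v3: "3 \<le> v A"
    using Min_less_v[of A] less.prems by simp
  show ?case
  proof (cases "Min ?A' = 1")
    case True
    then have "1 \<in> nash_iter 1 A"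
      using Min_in[OF A'(1,4)] by (simp add: nash_iter_def)
    then show ?thesis
      using v3 by (intro exI[of _ 1]) auto
  next
    case False
    then have "1 < Min ?A'"
      using A'(2) Min_in[OF A'(1,4)] by fastforce
    moreover have dec: "v ?A' \<le> v A - 2"
      using v_nash_step_le less.prems by blast
    ultimately obtain k where "int k \<le> v ?A' div 2" "1 \<in> nash_iter k ?A'"
      using less.hyps[of ?A'] A' v3 by auto
    then show ?thesis
      using dec by (intro exI[of _ "Suc k"]) (auto simp: nash_iter_Suc)
  qed
qed

theorem proposition3p7:
  fixes A :: "int set"
  assumes "finite A"
    and "\<forall>a\<in>A. 0 < a"
    and "Gcd A = 1"
  shows "(1 < Min A \<longrightarrow> v (nash_iter 1 A) \<le> v A - 2)
    \<and> (1 < Min A \<longrightarrow> (\<exists>k\<ge>1. int k \<le> \<lfloor>real_of_int (v A) / 2\<rfloor> \<and> 1 \<in> nash_iter k A))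
    \<and> int (eta A) \<le> \<lfloor>real_of_int (v A) / 2\<rfloor>"
proof -
  have half: "\<lfloor>real_of_int (v A) / 2\<rfloor> = v A div 2"
    using floor_divide_of_int_eq[of "v A" 2] by simp
  have step: "v (nash_iter 1 A) \<le> v A - 2" if "1 < Min A"
    using v_nash_step_le that assms by (simp add: nash_iter_def)
  have reach: "\<exists>k\<ge>1. int k \<le> v A div 2 \<and> 1 \<in> nash_iter k A" if "1 < Min A"
    using one_in_nash_iter that assms by blast
  have "int (eta A) \<le> v A div 2"
  proof (cases "1 < Min A")
    case True
    then obtain k where "int k \<le> v A div 2" "1 \<in> nash_iter k A"
      using reach by blast
    moreover from this have "eta A \<le> k"
      unfolding eta_def by (intro Least_le)
    ultimately show ?thesis by linarith
  next
    case False
    have ne: "A \<noteq> {}"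
      using assms(3) by auto
    then have "0 < Min A"
      using assms(1,2) by simp
    with False have "Min A = 1"
      by simp
    then have "1 \<in> nash_iter 0 A"
      using Min_in[OF assms(1) ne] by (simp add: nash_iter_def)
    then have "eta A = 0"
      unfolding eta_def by (simp add: Least_eq_0)
    moreover have "0 < v A"
      using assms v_attained(1) by blast
    ultimately show ?thesis by simp
  qed
  with step reach half show ?thesis by simp
qed

end
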